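(* Let $G$ be a simple graph with $n$ vertices, maximum degree $\Delta$, minimum degree $\delta$, and let $N_\Delta$, $N_\delta$ be the numbers of vertices of degree $\Delta$ and $\delta$, respectively. Then $$S(G)\ge \frac{2N_\Delta N_\delta}{n}(\Delta-\delta)=\frac{N_\Delta+N_\delta}{n}\,IRD(G),$$ with equality if and only if $G$ is regular or $G$ has exactly two distinct vertex degrees.
   Context: With $m$ the number of edges and $d_1,\dots,d_n$ the vertex degrees, $S(G)=\sum_{i=1}^n\left|d_i-\frac{2m}{n}\right|$. $IRD(G)=\frac{2N_\Delta N_\delta}{N_\delta+N_\Delta}(\Delta-\delta)$. (For a regular graph, $N_\Delta=N_\delta=n$.) *)

theory Defs
  imports Complex_Main "Graph_Theory.Digraph"
begin

text \<open>
  A finite simple graph is an instance of the locale \<^locale>\<open>graph\<close>: a finite symmetric digraph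
  without loops or parallel arcs. Every undirected edge is represented by its two
  opposite arcs, so the degree of a vertex is \<^const>\<open>out_degree\<close> (which agrees with
  \<^const>\<open>in_degree\<close>), while the edges have to be counted as unordered pairs of endpoints
  and not as arcs.
\<close>

definition undirected_edges :: "('a, 'b) pre_digraph \<Rightarrow> 'a set set" where
  "undirected_edges G = (\<lambda>e. {tail G e, head G e}) ` arcs G"

definition max_deg :: "('a, 'b) pre_digraph \<Rightarrow> nat" where
  "max_deg G = Max (out_degree G ` verts G)"

definition min_deg :: "('a, 'b) pre_digraph \<Rightarrow> nat" where
  "min_deg G = Min (out_degree G ` verts G)"

definition num_deg :: "('a, 'b) pre_digraph \<Rightarrow> nat \<Rightarrow> nat" where
  "num_deg G k = card {v \<in> verts G. out_degree G v = k}"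

definition degree_deviation :: "('a, 'b) pre_digraph \<Rightarrow> real" where
  "degree_deviation G =
    (\<Sum>v\<in>verts G. \<bar>real (out_degree G v)
       - 2 * real (card (undirected_edges G)) / real (card (verts G))\<bar>)"

definition IRD :: "('a, 'b) pre_digraph \<Rightarrow> real" where
  "IRD G =
    2 * real (num_deg G (max_deg G)) * real (num_deg G (min_deg G))
      / (real (num_deg G (min_deg G)) + real (num_deg G (max_deg G)))
      * (real (max_deg G) - real (min_deg G))"

definition regular_graph :: "('a, 'b) pre_digraph \<Rightarrow> bool" where
  "regular_graph G \<longleftrightarrow> (\<exists>k. \<forall>v\<in>verts G. out_degree G v = k)"

end

theory Submission
  imports Defs
begin

text \<open>
  The deviations of the degrees from their mean \<open>c = 2m/n\<close> sum to zero, so the sum of their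
  absolute values is at least twice the sum of the deviations over any set of vertices. For the
  vertices of maximum degree this gives \<open>S \<ge> 2 N\<^sub>\<Delta> (\<Delta> - c)\<close>, and for those of minimum degree
  \<open>S \<ge> 2 N\<^sub>\<delta> (c - \<delta>)\<close>. Weighting the first bound by \<open>N\<^sub>\<delta>\<close> and the second by \<open>N\<^sub>\<Delta>\<close> cancels \<open>c\<close>:
  \<open>(N\<^sub>\<Delta> + N\<^sub>\<delta>) S \<ge> 2 N\<^sub>\<Delta> N\<^sub>\<delta> (\<Delta> - \<delta>)\<close>, that is, \<open>S \<ge> IRD\<close>. If \<open>\<delta> < \<Delta>\<close>, then
  \<open>N\<^sub>\<Delta> + N\<^sub>\<delta> \<le> n\<close>, with equality exactly when no other degree occurs, and in that case the two
  bounds are equalities as well.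
\<close>

lemma (in fin_digraph) sum_out_degree: "(\<Sum>v\<in>verts G. out_degree G v) = card (arcs G)"
proof -
  have "arcs G = (\<Union>v\<in>verts G. out_arcs G v)" by auto
  also have "card \<dots> = (\<Sum>v\<in>verts G. out_degree G v)"
    unfolding out_degree_def by (rule card_UN_disjoint) auto
  finally show ?thesis by simp
qed

text \<open>Each fibre of the map from arcs to endpoint pairs is an arc together with its reverse:
  symmetry supplies the reverse, the absence of loops makes the two distinct, and the absence of
  parallel arcs excludes a third.\<close>

lemma (in graph) card_arcs: "card (arcs G) = 2 * card (undirected_edges G)"
proof -
  let ?ends = "\<lambda>e. {tail G e, head G e}"
  have fibre: "card {e' \<in> arcs G. ?ends e' = ?ends e} = 2" if e: "e \<in> arcs G" for e
  proof -
    obtain e2 where e2: "e2 \<in> arcs G" "tail G e = head G e2" "head G e = tail G e2"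
      using sym_arcs e unfolding symmetric_conv by blast
    have "e' = e \<or> e' = e2" if "e' \<in> arcs G" "?ends e' = ?ends e" for e'
      using that e e2 no_multi_arcs[of e' e] no_multi_arcs[of e' e2]
      by (auto simp: arc_to_ends_def doubleton_eq_iff)
    then have "{e' \<in> arcs G. ?ends e' = ?ends e} = {e, e2}"
      using e e2 by auto
    moreover have "e \<noteq> e2" using e e2 no_loops by metis
    ultimately show ?thesis by simp
  qed
  have "card (arcs G) = (\<Sum>x\<in>undirected_edges G. card {e' \<in> arcs G. ?ends e' = x})"
    unfolding undirected_edges_def card_eq_sum by (rule sum.image_gen) simp
  also have "\<dots> = (\<Sum>x\<in>undirected_edges G. 2)"
    by (rule sum.cong) (auto simp: undirected_edges_def fibre)
  finally show ?thesis by simp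
qed

text \<open>The function \<open>\<bar>x v\<bar> + x v\<close> dominates \<open>2 * x v\<close> and
  is nonnegative, so its sum only grows from \<open>A\<close> to \<open>V\<close>, where the second
  summand contributes nothing.\<close>

lemma twice_sum_le_sum_abs:
  fixes x :: "'a \<Rightarrow> real"
  assumes "finite V" "sum x V = 0" "A \<subseteq> V"
  shows "2 * sum x A \<le> (\<Sum>v\<in>V. \<bar>x v\<bar>)"
proof -
  have "2 * sum x A = (\<Sum>v\<in>A. 2 * x v)" by (simp add: sum_distrib_left)
  also have "\<dots> \<le> (\<Sum>v\<in>A. \<bar>x v\<bar> + x v)" by (rule sum_mono) auto
  also have "\<dots> \<le> (\<Sum>v\<in>V. \<bar>x v\<bar> + x v)" using assms by (intro sum_mono2) auto
  also have "\<dots> = (\<Sum>v\<in>V. \<bar>x v\<bar>)" using assms by (simp add: sum.distrib)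
  finally show ?thesis .
qed

text \<open>Under these sign conditions \<open>\<bar>x v\<bar> + x v\<close> equals
  \<open>2 * x v\<close> on \<open>A\<close> and vanishes on the rest of \<open>V\<close>, so no
  step of the preceding estimate loses anything.\<close>

lemma twice_sum_eq_sum_abs:
  fixes x :: "'a \<Rightarrow> real"
  assumes "finite V" "sum x V = 0" "A \<subseteq> V"
    and "\<And>v. v \<in> A \<Longrightarrow> 0 \<le> x v" "\<And>v. v \<in> V - A \<Longrightarrow> x v \<le> 0"
  shows "2 * sum x A = (\<Sum>v\<in>V. \<bar>x v\<bar>)"
proof -
  have "2 * sum x A = (\<Sum>v\<in>A. \<bar>x v\<bar> + x v)" using assms by (simp add: sum_distrib_left)
  also have "\<dots> = (\<Sum>v\<in>V. \<bar>x v\<bar> + x v)"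
    using assms by (intro sum.mono_neutral_left) auto
  also have "\<dots> = (\<Sum>v\<in>V. \<bar>x v\<bar>)" using assms by (simp add: sum.distrib)
  finally show ?thesis .
qed

lemma sum_abs_deviation_ge:
  fixes f :: "'a \<Rightarrow> real" and c p q :: real
  assumes "finite V" "(\<Sum>v\<in>V. f v - c) = 0"
  defines "a \<equiv> real (card {v \<in> V. f v = p})" and "b \<equiv> real (card {v \<in> V. f v = q})"
  shows "2 * a * b * (p - q) \<le> (a + b) * (\<Sum>v\<in>V. \<bar>f v - c\<bar>)"
proof -
  let ?S = "\<Sum>v\<in>V. \<bar>f v - c\<bar>"
  have "(\<Sum>v\<in>V. c - f v) = 0" using assms(2) by (simp add: sum_subtractf)
  \<comment> \<open>The negated deviations also sum to zero and have the same absolute values, so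
    the estimate applies to them as well.\<close>
  then have "2 * (b * (c - q)) \<le> ?S"
    using twice_sum_le_sum_abs[OF assms(1), of "\<lambda>v. c - f v" "{v \<in> V. f v = q}"]
    by (simp add: b_def abs_minus_commute)
  moreover have "2 * (a * (p - c)) \<le> ?S"
    using twice_sum_le_sum_abs[OF assms(1,2), of "{v \<in> V. f v = p}"] by (simp add: a_def)
  ultimately have "b * (2 * (a * (p - c))) + a * (2 * (b * (c - q))) \<le> b * ?S + a * ?S"
    by (intro add_mono mult_left_mono) (simp_all add: a_def b_def)
  then show ?thesis by (simp add: algebra_simps)
qed

lemma sum_abs_deviation_eq:
  fixes f :: "'a \<Rightarrow> real" and c p q :: real
  assumes "finite V" "(\<Sum>v\<in>V. f v - c) = 0" "f ` V = {p, q}" "q < p"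
  defines "a \<equiv> real (card {v \<in> V. f v = p})" and "b \<equiv> real (card {v \<in> V. f v = q})"
  shows "(a + b) * (\<Sum>v\<in>V. \<bar>f v - c\<bar>) = 2 * a * b * (p - q)"
proof -
  let ?S = "\<Sum>v\<in>V. \<bar>f v - c\<bar>"
  have V: "f v = p \<or> f v = q" if "v \<in> V" for v using assms(3) that by blast
  have ne: "V \<noteq> {}" using assms(3) by auto
  \<comment> \<open>The mean lies between the two values: otherwise all deviations would have the
    same strict sign and could not sum to zero. This yields the sign conditions for equality in both
    bounds.\<close>
  have "q \<le> c"
  proof (rule ccontr)
    assume "\<not> q \<le> c"
    then have "(\<Sum>v\<in>V. f v - c) > 0"
      using assms(1,4) ne V by (intro sum_pos) force+
    then show False using assms(2) by simp
  qed
  have neg: "(\<Sum>v\<in>V. c - f v) = 0" using assms(2) by (simp add: sum_subtractf)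
  have "c \<le> p"
  proof (rule ccontr)
    assume "\<not> c \<le> p"
    then have "(\<Sum>v\<in>V. c - f v) > 0"
      using assms(1,4) ne V by (intro sum_pos) force+
    then show False using neg by simp
  qed
  have "2 * (\<Sum>v\<in>{v \<in> V. f v = q}. c - f v) = (\<Sum>v\<in>V. \<bar>c - f v\<bar>)"
    using assms(1) neg V \<open>q \<le> c\<close> \<open>c \<le> p\<close> by (intro twice_sum_eq_sum_abs) force+
  then have B: "?S = 2 * (b * (c - q))" by (simp add: b_def abs_minus_commute)
  have "2 * (\<Sum>v\<in>{v \<in> V. f v = p}. f v - c) = ?S"
    using assms(1,2) V \<open>q \<le> c\<close> \<open>c \<le> p\<close> by (intro twice_sum_eq_sum_abs) force+
  then have A: "?S = 2 * (a * (p - c))" by (simp add: a_def)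
  have "(a + b) * ?S = b * ?S + a * ?S" by (simp add: algebra_simps)
  also have "\<dots> = b * (2 * (a * (p - c))) + a * (2 * (b * (c - q)))"
    using A B by simp
  finally show ?thesis by (simp add: algebra_simps)
qed

text \<open>By the handshake identity the degrees add up to twice the number of edges, which is also
  \<open>card (verts G)\<close> copies of the mean.\<close>

lemma (in graph) sum_degree_deviation:
  assumes "verts G \<noteq> {}"
  shows "(\<Sum>v\<in>verts G. real (out_degree G v)
       - 2 * real (card (undirected_edges G)) / real (card (verts G))) = 0"
proof -
  have "(\<Sum>v\<in>verts G. real (out_degree G v)) = 2 * real (card (undirected_edges G))"
    using sum_out_degree card_arcs by (metis of_nat_mult of_nat_numeral of_nat_sum)
  then show ?thesis using assms by (simp add: sum_subtractf)
qed

lemma regular_graph_iff: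
  assumes "finite (verts G)" "verts G \<noteq> {}"
  shows "regular_graph G \<longleftrightarrow> min_deg G = max_deg G"
proof
  assume "regular_graph G"
  then obtain k where "\<forall>v\<in>verts G. out_degree G v = k"
    unfolding regular_graph_def by blast
  then have "out_degree G ` verts G = {k}" using assms(2) by force
  then show "min_deg G = max_deg G" by (simp add: min_deg_def max_deg_def)
next
  assume eq: "min_deg G = max_deg G"
  have "out_degree G v = max_deg G" if "v \<in> verts G" for v
    using that assms(1) eq unfolding min_deg_def max_deg_def
    by (metis Max_ge Min_le antisym finite_imageI imageI)
  then show "regular_graph G" unfolding regular_graph_def by blast
qed

theorem theorem4:
  fixes G :: "('a, 'b) pre_digraph"
    and n \<Delta> \<delta> N\<^sub>\<Delta> N\<^sub>\<delta> :: nat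
  assumes "graph G"
    and "verts G \<noteq> {}"
    and "n = card (verts G)"
    and "\<Delta> = max_deg G"
    and "\<delta> = min_deg G"
    and "N\<^sub>\<Delta> = num_deg G \<Delta>"
    and "N\<^sub>\<delta> = num_deg G \<delta>"
  shows "degree_deviation G \<ge> 2 * real N\<^sub>\<Delta> * real N\<^sub>\<delta> / real n * (real \<Delta> - real \<delta>)
    \<and> 2 * real N\<^sub>\<Delta> * real N\<^sub>\<delta> / real n * (real \<Delta> - real \<delta>)
        = (real N\<^sub>\<Delta> + real N\<^sub>\<delta>) / real n * IRD G
    \<and> (degree_deviation G = 2 * real N\<^sub>\<Delta> * real N\<^sub>\<delta> / real n * (real \<Delta> - real \<delta>)
        \<longleftrightarrow> regular_graph G \<or> card (out_degree G ` verts G) = 2)"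
proof -
  interpret graph G by fact
  let ?V = "verts G" and ?f = "\<lambda>v. real (out_degree G v)" and ?S = "degree_deviation G"
  define c where "c = 2 * real (card (undirected_edges G)) / real (card ?V)"
  define A where "A = {v \<in> ?V. out_degree G v = \<Delta>}"
  define B where "B = {v \<in> ?V. out_degree G v = \<delta>}"
  have zero: "(\<Sum>v\<in>?V. ?f v - c) = 0"
    unfolding c_def using sum_degree_deviation assms(2) .
  have S: "?S = (\<Sum>v\<in>?V. \<bar>?f v - c\<bar>)" by (simp add: degree_deviation_def c_def)
  have cards: "N\<^sub>\<Delta> = card A" "N\<^sub>\<delta> = card B"
    using assms by (simp_all add: num_deg_def A_def B_def)
  have mem: "\<Delta> \<in> out_degree G ` ?V" "\<delta> \<in> out_degree G ` ?V"
    using assms(2) by (simp_all add: assms(4,5) max_deg_def min_deg_def)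
  then have "A \<noteq> {}" "B \<noteq> {}" unfolding A_def B_def by blast+
  moreover have fin: "finite A" "finite B" by (simp_all add: A_def B_def)
  ultimately have pos: "N\<^sub>\<Delta> > 0" "N\<^sub>\<delta> > 0" by (simp_all add: cards card_gt_0_iff)
  have n: "n > 0" using assms(2,3) by (simp add: card_gt_0_iff)
  have bounds: "\<delta> \<le> out_degree G v" "out_degree G v \<le> \<Delta>" if "v \<in> ?V" for v
    using that by (simp_all add: assms(4,5) max_deg_def min_deg_def)
  have ird: "2 * real N\<^sub>\<Delta> * real N\<^sub>\<delta> / real n * (real \<Delta> - real \<delta>)
      = (real N\<^sub>\<Delta> + real N\<^sub>\<delta>) / real n * IRD G"
  proof -
    have "real N\<^sub>\<delta> + real N\<^sub>\<Delta> \<noteq> 0" using pos by linarith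
    then show ?thesis
      unfolding IRD_def assms(4-7)[symmetric] by (simp add: add.commute)
  qed
  show ?thesis
  \<comment> \<open>If the extreme degrees coincide, then \<open>A = B\<close> and
    \<open>N\<^sub>\<Delta> + N\<^sub>\<delta>\<close> is \<open>2 * n\<close>, so the comparison
    with \<open>n\<close> fails; but then the mean is \<Delta> and both sides are zero.\<close>
  proof (cases "\<delta> = \<Delta>")
    case True
    then have f: "out_degree G v = \<Delta>" if "v \<in> ?V" for v using bounds[OF that] by simp
    then have "?S = 0" using zero n assms(3) by (simp add: S)
    moreover have "regular_graph G" using f unfolding regular_graph_def by blast
    ultimately show ?thesis using ird True by simp
  next
    case False
    then have less: "\<delta> < \<Delta>" using mem bounds by fastforce
    have nreg: "\<not> regular_graph G"
      using False assms(2) by (simp add: regular_graph_iff assms(4,5))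
    have cardf: "card {v \<in> ?V. ?f v = real \<Delta>} = N\<^sub>\<Delta>" "card {v \<in> ?V. ?f v = real \<delta>} = N\<^sub>\<delta>"
      by (simp_all add: cards A_def B_def)
    define R where "R = 2 * real N\<^sub>\<Delta> * real N\<^sub>\<delta> * (real \<Delta> - real \<delta>)"
    have R: "R > 0" using less pos by (simp add: R_def)
    have ge: "R \<le> (real N\<^sub>\<Delta> + real N\<^sub>\<delta>) * ?S"
      using sum_abs_deviation_ge[OF finite_verts zero, of "real \<Delta>" "real \<delta>"]
      unfolding cardf S R_def by simp
    then have "(real N\<^sub>\<Delta> + real N\<^sub>\<delta>) * ?S > 0" using R by linarith
    \<comment> \<open>Strict positivity allows \<open>?S\<close> to be cancelled in the equality
      case.\<close>
    then have Spos: "?S > 0" using pos by (simp add: zero_less_mult_iff)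
    have AB: "card (A \<union> B) = N\<^sub>\<Delta> + N\<^sub>\<delta>"
      unfolding cards using fin False by (intro card_Un_disjoint) (auto simp: A_def B_def)
    have sub: "A \<union> B \<subseteq> ?V" by (auto simp: A_def B_def)
    have le: "N\<^sub>\<Delta> + N\<^sub>\<delta> \<le> n"
      unfolding assms(3) AB[symmetric] by (rule card_mono) (use sub in auto)
    then have le_S: "(real N\<^sub>\<Delta> + real N\<^sub>\<delta>) * ?S \<le> real n * ?S"
      using Spos by (intro mult_right_mono) linarith+
    \<comment> \<open>Both extreme degrees always occur, so two distinct degrees can only be
      these.\<close>
    have two: "card (out_degree G ` ?V) = 2 \<longleftrightarrow> out_degree G ` ?V = {\<Delta>, \<delta>}"
    proof
      assume "card (out_degree G ` ?V) = 2"
      then have "{\<Delta>, \<delta>} = out_degree G ` ?V"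
        using mem False by (intro card_subset_eq) auto
      then show "out_degree G ` ?V = {\<Delta>, \<delta>}" by simp
    qed (use False in simp)
    have "real n * ?S = R \<longleftrightarrow> card (out_degree G ` ?V) = 2"
    proof
      assume "real n * ?S = R"
      \<comment> \<open>The chain \<open>R \<le> (real N\<^sub>\<Delta> + real N\<^sub>\<delta>) *
        ?S \<le> real n * ?S\<close> collapses, so the vertices of extreme degree exhaust the
        graph.\<close>
      then have "real n * ?S = (real N\<^sub>\<Delta> + real N\<^sub>\<delta>) * ?S" using ge le_S by linarith
      then have "real n = real N\<^sub>\<Delta> + real N\<^sub>\<delta>" using Spos by simp
      then have "card (A \<union> B) = card ?V" unfolding AB assms(3)[symmetric] by linarith
      then have "A \<union> B = ?V" using sub by (intro card_subset_eq) auto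
      then have "out_degree G ` ?V = {\<Delta>, \<delta>}"
        using mem by (auto simp: A_def B_def)
      then show "card (out_degree G ` ?V) = 2" using two by simp
    next
      assume "card (out_degree G ` ?V) = 2"
      then have im: "out_degree G ` ?V = {\<Delta>, \<delta>}" using two by simp
      then have "?f ` ?V = {real \<Delta>, real \<delta>}" by (simp flip: image_image)
      then have "(real N\<^sub>\<Delta> + real N\<^sub>\<delta>) * ?S = R"
        using sum_abs_deviation_eq[OF finite_verts zero, of "real \<Delta>" "real \<delta>"] less
        unfolding cardf S R_def by simp
      moreover have "A \<union> B = ?V" using im by (auto simp: A_def B_def)
      then have "real n = real N\<^sub>\<Delta> + real N\<^sub>\<delta>" using AB assms(3) by simp
      ultimately show "real n * ?S = R" by simp
    qed
    moreover have "2 * real N\<^sub>\<Delta> * real N\<^sub>\<delta> / real n * (real \<Delta> - real \<delta>) = R / real n"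
      by (simp add: R_def)
    moreover have "R / real n \<le> ?S" using ge le_S n by (simp add: field_simps)
    moreover have "?S = R / real n \<longleftrightarrow> real n * ?S = R" using n by (auto simp: field_simps)
    ultimately show ?thesis using ird nreg by metis
  qed
qed

end
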